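(* Let $n$ be a positive integer, let $V_l(n)=\{v\in V(n):\Omega(v)=l\}$, and let $E^H_l(n)=\{(a,b)\in E^H(n): a\in V_l(n)\}$. Then for every integer $l$ with $0\le l\le \Omega(n)-1$, $|E^H_l(n)|=|E^H_{\Omega(n)-l-1}(n)|$.
   Context: $V(n)$ is the set of positive divisors of $n$; $\Omega(m)$ is the number of prime factors of $m$ counted with multiplicity. $E^H(n)$ is the arc set of the Hasse diagram $G^H(n)$: the pairs $(a,b)$ with $a,b\in V(n)$, $a<b$, $a\mid b$, such that there is no $c\in V(n)$ with $a<c<b$, $a\mid c$, $c\mid b$ (equivalently, $b/a$ is prime). *)

theory Defs
  imports "HOL-Computational_Algebra.Primes"
begin

definition divisors_of :: "nat \<Rightarrow> nat set" where
  "divisors_of n = {d. d > 0 \<and> d dvd n}"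

definition big_omega :: "nat \<Rightarrow> nat" where
  "big_omega m = size (prime_factorization m)"

definition level :: "nat \<Rightarrow> nat \<Rightarrow> nat set" where
  "level n l = {v \<in> divisors_of n. big_omega v = l}"

definition hasse_arcs :: "nat \<Rightarrow> (nat \<times> nat) set" where
  "hasse_arcs n = {(a, b). a \<in> divisors_of n \<and> b \<in> divisors_of n \<and> a < b \<and> a dvd b \<and>
     \<not> (\<exists>c \<in> divisors_of n. a < c \<and> c < b \<and> a dvd c \<and> c dvd b)}"

definition hasse_arcs_level :: "nat \<Rightarrow> nat \<Rightarrow> (nat \<times> nat) set" where
  "hasse_arcs_level n l = {(a, b) \<in> hasse_arcs n. a \<in> level n l}"

end

theory Submission
  imports Defs
begin

text \<open>
  The map \<open>(a, b) \<mapsto> (n / b, n / a)\<close> is an order-reversing involution on the arcs of the Hasse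
  diagram. Since \<open>\<Omega>(b) = \<Omega>(a) + 1\<close> along an arc, it exchanges the levels \<open>l\<close> and \<open>\<Omega>(n) - l - 1\<close>.
\<close>

lemma big_omega_mult:
  assumes "a > 0" "b > 0"
  shows "big_omega (a * b) = big_omega a + big_omega b"
  using assms by (simp add: big_omega_def prime_factorization_mult)

lemma big_omega_prime: "prime p \<Longrightarrow> big_omega p = 1"
  by (simp add: big_omega_def prime_factorization_prime)

text \<open>This replaces the minimality condition by a prime quotient, which makes both the jump of
  \<open>big_omega\<close> along an arc and the passage to complementary divisors immediate.\<close>

lemma hasse_arcs_iff:
  "(a, b) \<in> hasse_arcs n \<longleftrightarrow> a > 0 \<and> b > 0 \<and> b dvd n \<and> (\<exists>p. prime p \<and> b = a * p)"
proof
  assume arc: "(a, b) \<in> hasse_arcs n"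
  then have pos: "a > 0" "b > 0" "b dvd n" and "a < b" and "a dvd b"
    and min: "\<And>c. c > 0 \<Longrightarrow> c dvd n \<Longrightarrow> a < c \<Longrightarrow> c < b \<Longrightarrow> a dvd c \<Longrightarrow> \<not> c dvd b"
    by (auto simp: hasse_arcs_def divisors_of_def)
  from \<open>a dvd b\<close> obtain q where q: "b = a * q" by blast
  with \<open>a < b\<close> have "q \<noteq> 1" by auto
  then obtain p where p: "prime p" "p dvd q" using prime_factor_nat by blast
  \<comment> \<open>The candidate for an intermediate divisor is \<open>a * p\<close>, with
    \<open>p\<close> any prime factor of \<open>b / a\<close>; minimality of the arc leaves only
    \<open>a * p = b\<close>.\<close>
  have c: "a < a * p" "a dvd a * p" "a * p dvd b"
    using pos p prime_gt_1_nat[OF p(1)] by (auto simp: q)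
  then have "\<not> a * p < b"
    using min[of "a * p"] pos dvd_trans[OF c(3) pos(3)] by auto
  moreover have "a * p \<le> b" using c pos by (simp add: dvd_imp_le)
  ultimately have "b = a * p" by simp
  with pos p show "a > 0 \<and> b > 0 \<and> b dvd n \<and> (\<exists>p. prime p \<and> b = a * p)" by blast
next
  assume "a > 0 \<and> b > 0 \<and> b dvd n \<and> (\<exists>p. prime p \<and> b = a * p)"
  then obtain p where pos: "a > 0" "b > 0" "b dvd n" and p: "prime p" "b = a * p" by blast
  have "\<not> c dvd b" if "a < c" "c < b" "a dvd c" for c
  proof
    assume "c dvd b"
    from \<open>a dvd c\<close> obtain d where d: "c = a * d" by blast
    with \<open>c dvd b\<close> p pos have "d dvd p" by simp
    \<comment> \<open>The two cases mean \<open>c = a\<close> and \<open>c = b\<close>, both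
      excluded by strictness.\<close>
    then have "d = 1 \<or> d = p" using p(1) by (auto simp: prime_nat_iff)
    with d that p show False by auto
  qed
  moreover have "a < b" using p pos prime_gt_1_nat[OF p(1)] by simp
  moreover have "a dvd n" using p pos dvd_mult_left by blast
  ultimately show "(a, b) \<in> hasse_arcs n"
    using pos p by (auto simp: hasse_arcs_def divisors_of_def)
qed

text \<open>Writing \<open>n = a * p * k\<close> with \<open>b = a * p\<close> turns the
  complementary pair into \<open>(k, k * p)\<close>, an arc with the same prime quotient. The two
  double-quotient identities make the map its own inverse.\<close>

lemma complement_hasse_arcs_level:
  assumes "n > 0" and "(a, b) \<in> hasse_arcs_level n l"
  shows "(n div b, n div a) \<in> hasse_arcs_level n (big_omega n - l - 1)"
    and "n div (n div a) = a" and "n div (n div b) = b"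
proof -
  from assms(2) have arc: "(a, b) \<in> hasse_arcs n" and l: "big_omega a = l"
    by (auto simp: hasse_arcs_level_def level_def)
  from arc obtain p where ab: "a > 0" "b > 0" "b dvd n" and p: "prime p" "b = a * p"
    by (auto simp: hasse_arcs_iff)
  then obtain k where k: "n = a * p * k" by blast
  have pos: "p > 0" "k > 0" using k \<open>n > 0\<close> by auto
  have quot: "n div b = k" "n div a = k * p"
    using ab pos by (simp_all add: k p(2) mult.assoc mult.commute[of p k])
  show "n div (n div a) = a" "n div (n div b) = b"
    using pos by (simp_all add: quot k p(2) ac_simps)
  \<comment> \<open>The summand 1 comes from \<open>p\<close>; it is the source of the shift in the
    target level.\<close>
  have "big_omega n = l + 1 + big_omega k"
    using ab pos l p(1) by (simp add: k big_omega_mult big_omega_prime)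
  then have "big_omega k = big_omega n - l - 1" by simp
  moreover have "(k, k * p) \<in> hasse_arcs n"
    unfolding hasse_arcs_iff using pos p(1) by (auto simp: k)
  ultimately show "(n div b, n div a) \<in> hasse_arcs_level n (big_omega n - l - 1)"
    using k pos unfolding quot by (simp add: hasse_arcs_level_def level_def divisors_of_def)
qed

theorem theorem5:
  fixes n l :: nat
  assumes "n > 0" and "l < big_omega n"
  shows "card (hasse_arcs_level n l) = card (hasse_arcs_level n (big_omega n - l - 1))"
proof -
  let ?f = "\<lambda>(a, b). (n div b, n div a)"
  \<comment> \<open>As \<open>l < big_omega n\<close>, the subtraction on naturals is not truncated,
    so reflecting the level twice returns \<open>l\<close>. The preceding lemma therefore also
    applies from the target level back.\<close>
  have "big_omega n - (big_omega n - l - 1) - 1 = l" using assms(2) by simp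
  then have "bij_betw ?f (hasse_arcs_level n l) (hasse_arcs_level n (big_omega n - l - 1))"
    using complement_hasse_arcs_level[OF assms(1)]
    by (intro bij_betw_byWitness[where f' = ?f]) (fastforce)+
  then show ?thesis by (rule bij_betw_same_card)
qed

end
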